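(* For every integer $b\geq 2$, let $\eta_{\mathbf{d},b}=\sum_{n\geq 0}d_n b^{-n}$, where $d_n=c_n+c_{n+2}$ and $\mathbf{c}=(c_n)_{n\ge0}$ is the Cantor sequence. The irrationality exponent of $\eta_{\mathbf{d},b}$ is equal to $2$.
   Context: The Cantor sequence $\mathbf{c}=(c_n)_{n\ge 0}\in\{0,1\}^{\mathbb{N}}$ is defined by $c_0=1$, $c_{3n}=c_n$, $c_{3n+1}=0$, $c_{3n+2}=c_n$ for $n\ge 0$ (equivalently, $c_n=1$ if the base-$3$ expansion of $n$ contains no digit $1$, and $c_n=0$ otherwise). The irrationality exponent of an irrational real number $\xi$ is $\mu(\xi)=\sup\{\mu\in\mathbb{R} : |\xi-\frac{p}{q}|<\frac{1}{q^{\mu}} \text{ for infinitely many } (p,q)\in\mathbb{Z}\times\mathbb{N}\}$, where $q\ge 1$. *)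

theory Defs
  imports "HOL-Analysis.Analysis" "HOL-Library.Extended_Real"
begin

fun cantor :: "nat \<Rightarrow> nat" where
  "cantor n = (if n = 0 then 1 else if n mod 3 = 1 then 0 else cantor (n div 3))"

declare cantor.simps [simp del]

lemma cantor_0: "cantor 0 = 1"
  by (simp add: cantor.simps)

lemma cantor_3n: "cantor (3 * n) = cantor n"
  by (cases "n = 0") (simp_all add: cantor.simps [of "3 * n"] cantor_0)

lemma cantor_3n_1: "cantor (3 * n + 1) = 0"
proof -
  have "(3 * n + 1) mod 3 = 1" by presburger
  then show ?thesis by (subst cantor.simps) simp
qed

lemma cantor_3n_2: "cantor (3 * n + 2) = cantor n"
proof -
  have "(3 * n + 2) mod 3 = 2" "(3 * n + 2) div 3 = n" by presburger+
  then show ?thesis by (subst cantor.simps) simp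
qed

definition cantor_d :: "nat \<Rightarrow> nat" where
  "cantor_d n = cantor n + cantor (n + 2)"

definition eta_d :: "int \<Rightarrow> real" where
  "eta_d b = (\<Sum>n. real (cantor_d n) / real_of_int b ^ n)"

(* The supremum is taken in the extended reals, so that it is \<infinity> when the
   set of exponents is unbounded; in a conditionally complete order it would be unspecified. *)
definition irrationality_exponent :: "real \<Rightarrow> ereal" where
  "irrationality_exponent \<xi> =
     Sup (ereal ` {\<mu>. infinite {(p :: int, q :: nat).
       q \<ge> 1 \<and> \<bar>\<xi> - real_of_int p / real q\<bar> < 1 / real q powr \<mu>}})"

end

theory Submission
  imports Defs
begin

text \<open>
  Let \<open>C(z)\<close> be the generating function of the Cantor sequence, so that \<open>C(z) = (1 + z^2) C(z^3)\<close> and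
  \<open>eta_d b = (b^2 + 1) C(1/b) - b^2\<close>. Modulo 3, the series \<open>f = (1 + z^2) C\<close> is a square root of
  \<open>1 + z^2\<close>. Linear algebra gives integer polynomials \<open>Q, P\<close> of degree at most \<open>n\<close> such that \<open>Q f - P\<close>
  vanishes to order at least \<open>2n + 1\<close> and \<open>Q\<close> is primitive. As \<open>(1 + z^2) Q^2 - P^2\<close> is nonzero modulo 3
  and has degree at most \<open>2n + 2\<close>, the order of vanishing is exactly \<open>2n + 1\<close> or \<open>2n + 2\<close>. Substituting
  \<open>z = 1/N\<close> with \<open>N = b^(3^m)\<close> and using the functional equation \<open>m\<close> times yields integers \<open>u, v\<close> with
  \<open>|u| \<le> N^(n+4)\<close> and \<open>N^(-n) \<le> |u eta_d b - v| \<le> N^(3-n)\<close>. For \<open>n\<close> between \<open>K\<close> and \<open>3K\<close>, the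
  scales \<open>N^n\<close> are so dense that every rational \<open>p/q\<close> with \<open>q\<close> large has distance at least
  \<open>q^(-2-14/K)\<close> from \<open>eta_d b\<close>.
\<close>

section \<open>Underdetermined linear systems over an integral domain\<close>

text \<open>Gaussian elimination without division, by induction on the equations: multiplying
  through by the pivot keeps the solution in the ring, so integer systems get integer
  solutions.\<close>

lemma homogeneous_system_nontrivial:
  fixes A :: "'j \<Rightarrow> 'i \<Rightarrow> 'a::idom"
  assumes "finite J" "finite I" "card J < card I"
  shows "\<exists>x. (\<exists>i\<in>I. x i \<noteq> 0) \<and> (\<forall>j\<in>J. (\<Sum>i\<in>I. A j i * x i) = 0)"
  using assms
proof (induction J arbitrary: I A rule: finite_induct)
  case empty
  then obtain i where "i \<in> I"
    by fastforce
  then show ?case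
    by (intro exI [of _ "\<lambda>_. 1"]) auto
next
  case (insert j J)
  show ?case
  proof (cases "\<forall>i\<in>I. A j i = 0")
    case True
    have "card J < card I"
      using insert by simp
    from insert.IH [OF insert.prems(1) this, of A] obtain x
      where "\<exists>i\<in>I. x i \<noteq> 0" "\<forall>j\<in>J. (\<Sum>i\<in>I. A j i * x i) = 0"
      by blast
    with True show ?thesis
      by (intro exI [of _ x]) auto
  next
    case False
    then obtain i0 where i0: "i0 \<in> I" "A j i0 \<noteq> 0"
      by blast
    define I' where "I' = I - {i0}"
    have I': "finite I'" "i0 \<notin> I'" "I = insert i0 I'"
      using insert.prems i0 by (auto simp: I'_def)
    have "card J < card I'"
      using insert I' by simp
    \<comment> \<open>The remaining equations are cross-multiplied with equation \<open>j\<close> so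
      that the pivot variable \<open>i0\<close> drops out.\<close>
    from insert.IH [OF I'(1) this, of "\<lambda>k i. A j i0 * A k i - A k i0 * A j i"] obtain x
      where x: "\<exists>i\<in>I'. x i \<noteq> 0"
        and eq: "\<And>k. k \<in> J \<Longrightarrow> (\<Sum>i\<in>I'. (A j i0 * A k i - A k i0 * A j i) * x i) = 0"
      by blast
    \<comment> \<open>Back substitution: the old unknowns are scaled by the pivot
      \<open>A j i0\<close>, so solving equation \<open>j\<close> for \<open>i0\<close> involves no
      quotient.\<close>
    define y where "y i = (if i = i0 then - (\<Sum>i\<in>I'. A j i * x i) else A j i0 * x i)" for i
    have sum_y: "(\<Sum>i\<in>I. A k i * y i)
        = A j i0 * (\<Sum>i\<in>I'. A k i * x i) - A k i0 * (\<Sum>i\<in>I'. A j i * x i)" for k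
    proof -
      have "(\<Sum>i\<in>I'. A k i * y i) = (\<Sum>i\<in>I'. A j i0 * (A k i * x i))"
        using I'(2) by (intro sum.cong) (auto simp: y_def)
      then show ?thesis
        using I' by (simp add: y_def sum_distrib_left)
    qed
    have "(\<Sum>i\<in>I. A k i * y i) = 0" if "k \<in> J" for k
      using eq [OF that]
      by (simp add: sum_y left_diff_distrib sum_subtractf sum_distrib_left mult.assoc)
    moreover have "(\<Sum>i\<in>I. A j i * y i) = 0"
      by (simp add: sum_y)
    moreover have "\<exists>i\<in>I. y i \<noteq> 0"
      using x i0(2) I' by (auto simp: y_def)
    ultimately show ?thesis
      by (intro exI [of _ y]) auto
  qed
qed

section \<open>Partial products of the generating function\<close>

text \<open>For y = x^2 this is the factor between C(x) and C(x^(3^m)). It is polymorphic because it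
  serves both for integer polynomials and for real numbers.\<close>

definition cantor_prod :: "nat \<Rightarrow> 'a \<Rightarrow> 'a::comm_ring_1" where
  "cantor_prod m y = (\<Prod>j<m. 1 + y ^ 3 ^ j)"

lemma cantor_prod_Suc: "cantor_prod (Suc m) y = cantor_prod m y * (1 + y ^ 3 ^ m)"
  by (simp add: cantor_prod_def)

text \<open>Frobenius modulo 3: with t = y^(3^m), the next factor multiplies the left side by (1 +
  t)^2, and (1 + t)^3 is congruent to 1 + t^3. Since y^(3^m) has high order, (1 + z^2) C^2 is 1
  modulo 3.\<close>

lemma cantor_prod_square_mod_3:
  fixes y :: "'a::comm_ring_1"
  shows "3 dvd (1 + y) * cantor_prod m y ^ 2 - (1 + y ^ 3 ^ m)"
proof (induction m)
  case 0
  then show ?case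
    by (simp add: cantor_prod_def)
next
  case (Suc m)
  define t where "t = y ^ 3 ^ m"
  have t3: "y ^ 3 ^ Suc m = t ^ 3"
    by (simp add: t_def power_mult [symmetric] mult.commute)
  have "(1 + y) * cantor_prod (Suc m) y ^ 2 - (1 + t ^ 3)
      = ((1 + y) * cantor_prod m y ^ 2 - (1 + t)) * (1 + t) ^ 2 + 3 * (t + t ^ 2)"
    unfolding cantor_prod_Suc t_def [symmetric]
    by (simp add: algebra_simps power2_eq_square power3_eq_cube)
  also have "3 dvd \<dots>"
    using Suc.IH unfolding t_def [symmetric] by (intro dvd_add dvd_mult2) auto
  finally show ?case
    unfolding t3 .
qed

lemma cantor_digit: "r < 3 \<Longrightarrow> cantor (3 * n + r) = (if r = 1 then 0 else cantor n)"
  using cantor_3n [of n] cantor_3n_1 [of n] cantor_3n_2 [of n]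
  by (auto simp: less_Suc_eq numeral_3_eq_3 numeral_2_eq_2)

lemma cantor_le_1: "cantor n \<le> 1"
  by (induction n rule: cantor.induct) (subst cantor.simps, simp)

text \<open>Here \<open>k\<close> is read with \<open>m\<close> ternary digits, leading zeros
  included, and a digit 1 or 2 is prepended. The recursion of \<open>cantor\<close> acts on the last
  digit, so the induction splits off \<open>k mod 3\<close>.\<close>

lemma cantor_leading_digit:
  assumes "k < 3 ^ m"
  shows "cantor (3 ^ m + k) = 0 \<and> cantor (2 * 3 ^ m + k) = cantor k"
  using assms
proof (induction m arbitrary: k)
  case 0
  then show ?case
    using cantor_3n_1 [of 0] cantor_3n_2 [of 0] by (simp add: numeral_2_eq_2)
next
  case (Suc m)
  define l r where "l = k div 3" and "r = k mod 3"
  have k: "k = 3 * l + r" "r < 3"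
    by (simp_all add: l_def r_def)
  have "l < 3 ^ m"
    using Suc.prems by (simp add: l_def div_less_iff_less_mult mult.commute)
  note IH = Suc.IH [OF this]
  have "3 ^ Suc m + k = 3 * (3 ^ m + l) + r" "2 * 3 ^ Suc m + k = 3 * (2 * 3 ^ m + l) + r"
    by (simp_all add: k)
  then show ?case
    using IH by (simp only: k(1) cantor_digit [OF k(2)] split: if_split) simp
qed

text \<open>The factor 1 + z^(2 * 3^m) chooses 0 or 2 as the ternary digit in position
  \<open>m\<close>; the product is therefore C truncated at order 3^m.\<close>

lemma coeff_cantor_prod:
  "coeff (cantor_prod m (monom 1 2) :: int poly) k = (if k < 3 ^ m then int (cantor k) else 0)"
proof (induction m arbitrary: k)
  case 0
  then show ?case
    by (simp add: cantor_prod_def cantor_0)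
next
  case (Suc m)
  have mono: "(monom 1 2 :: int poly) ^ 3 ^ m = monom 1 (2 * 3 ^ m)"
    by (simp add: monom_power)
  have split: "coeff (cantor_prod (Suc m) (monom 1 2) :: int poly) k
     = (if k < 3 ^ m then int (cantor k) else 0)
       + (if k < 2 * 3 ^ m then 0 else if k - 2 * 3 ^ m < 3 ^ m then int (cantor (k - 2 * 3 ^ m)) else 0)"
    unfolding cantor_prod_Suc mono
    by (simp add: distrib_left coeff_monom_mult Suc.IH mult.commute [of _ "monom _ _"])
  consider "k < 3 ^ m" | "3 ^ m \<le> k" "k < 2 * 3 ^ m" | "2 * 3 ^ m \<le> k"
    by linarith
  then show ?case
  proof cases
    case 1
    then show ?thesis by (simp add: split)
  next
    case 2
    then show ?thesis
      using cantor_leading_digit [of "k - 3 ^ m" m] by (simp add: split)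
  next
    case 3
    then show ?thesis
      using cantor_leading_digit [of "k - 2 * 3 ^ m" m] by (auto simp: split)
  qed
qed

section \<open>Integer polynomials modulo 3 and modulo x^2 + 1\<close>

text \<open>As x^2 + 1 is monic, division with remainder stays in the integers; the remainder is
  given by its two coefficients so that congruences between them can be read off.\<close>

lemma int_poly_division_x2_plus_1:
  fixes P :: "int poly"
  obtains S a b where "P = [:1, 0, 1:] * S + [:a, b:]"
proof -
  have "\<exists>S a b. P = [:1, 0, 1:] * S + [:a, b:]"
  proof (induction P)
    case 0
    show ?case
      by (rule exI [of _ 0], rule exI [of _ 0], rule exI [of _ 0]) simp
  next
    case (pCons c P)
    then obtain S a b where P: "P = [:1, 0, 1:] * S + [:a, b:]"
      by blast
    have "pCons c P = [:1, 0, 1:] * pCons b S + [:c - b, a:]"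
      by (simp add: P)
    then show ?case
      by blast
  qed
  then show ?thesis
    using that by blast
qed

lemma x2_plus_1_times_eq_linear:
  fixes S :: "int poly"
  assumes "[:1, 0, 1:] * S = [:a, b:]"
  shows "a = 0" "b = 0"
proof -
  have "S = 0"
  proof (rule ccontr)
    assume "S \<noteq> 0"
    then have "degree ([:1, 0, 1:] * S) \<ge> 2"
      by (subst degree_mult_eq) auto
    moreover have "degree [:a, b:] \<le> 1"
      by simp
    ultimately show False
      unfolding assms by simp
  qed
  with assms show "a = 0" "b = 0"
    by auto
qed

lemma prime_3_int_poly: "prime_elem (3 :: int poly)"
proof -
  have "prime_elem [:3 :: int:]"
    by (subst prime_elem_const_poly_iff) simp
  then show ?thesis
    by (simp add: numeral_poly)
qed

lemma three_dvd_int_poly_iff: "(3 :: int poly) dvd P \<longleftrightarrow> (\<forall>k. 3 dvd coeff P k)"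
  using const_poly_dvd_iff [of "3 :: int" P] by (simp add: numeral_poly)

text \<open>
  Descent: \<open>x^2 + 1\<close> is prime modulo 3, hence it divides \<open>P\<close> modulo 3, and the quotient \<open>S\<close> gives the
  smaller pair \<open>(Q, S)\<close> in place of \<open>(P, Q)\<close>.
\<close>
lemma three_dvd_if_square_mod_3:
  fixes P Q :: "int poly"
  assumes "3 dvd [:1, 0, 1:] * Q ^ 2 - P ^ 2"
  shows "3 dvd Q"
  using assms
proof (induction "degree P + degree Q" arbitrary: P Q rule: less_induct)
  case less
  let ?g = "[:1, 0, 1:] :: int poly"
  obtain S a b where P: "P = ?g * S + [:a, b:]"
    by (rule int_poly_division_x2_plus_1)
  obtain R where R: "?g * Q ^ 2 - P ^ 2 = 3 * R"
    using less.prems by blast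
  obtain R' c d where R': "R = ?g * R' + [:c, d:]"
    by (rule int_poly_division_x2_plus_1)
  \<comment> \<open>The square is reduced by means of x^2 = -1 modulo \<open>?g\<close>.\<close>
  have sq: "[:a, b:] ^ 2 = ?g * [:b ^ 2:] + [:a ^ 2 - b ^ 2, 2 * a * b:]"
    by (simp add: power2_eq_square)
  have lin: "[:a ^ 2 - b ^ 2 + 3 * c, 2 * a * b + 3 * d:] = [:a ^ 2 - b ^ 2, 2 * a * b:] + 3 * [:c, d:]"
    by (simp add: numeral_poly)
  have "[:a ^ 2 - b ^ 2, 2 * a * b:] = [:a, b:] ^ 2 - ?g * [:b ^ 2:]"
    unfolding sq by simp
  moreover have "3 * [:c, d:] = ?g * Q ^ 2 - P ^ 2 - 3 * (?g * R')"
    unfolding R R' by (simp only: algebra_simps)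
  \<comment> \<open>All multiples of \<open>?g\<close> are gathered on the left, leaving a
    polynomial of degree at most 1 on the right, whose coefficients must then vanish.\<close>
  ultimately have "?g * (Q ^ 2 - ?g * S ^ 2 - 2 * S * [:a, b:] - [:b ^ 2:] - 3 * R')
      = [:a ^ 2 - b ^ 2 + 3 * c, 2 * a * b + 3 * d:]"
    unfolding lin P power2_sum by (simp only: algebra_simps power2_eq_square)
  from x2_plus_1_times_eq_linear [OF this]
  have eqs: "a ^ 2 - b ^ 2 + 3 * c = 0" "2 * a * b + 3 * d = 0"
    by simp_all
  \<comment> \<open>Modulo 3, a b = 0 and a^2 = b^2: one of \<open>a\<close>, \<open>b\<close> is
    divisible by 3, and then so is the other.\<close>
  have "2 * (a * b) = 3 * - d"
    using eqs(2) by simp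
  then have "3 dvd a * b"
    by presburger
  then have "3 dvd a \<or> 3 dvd b"
    using prime_dvd_mult_iff [of 3 a b] by simp
  moreover have "a ^ 2 - b ^ 2 = 3 * - c"
    using eqs(1) by simp
  then have "3 dvd a ^ 2 \<longleftrightarrow> 3 dvd b ^ 2"
    by presburger
  then have "3 dvd a \<longleftrightarrow> 3 dvd b"
    using prime_dvd_power_iff [of "3::int" 2] by simp
  ultimately have "3 dvd a" "3 dvd b"
    by auto
  then have "3 dvd [:a, b:]"
    by (auto simp: three_dvd_int_poly_iff coeff_pCons split: nat.split)
  moreover have "P ^ 2 - (?g * S) ^ 2 = [:a, b:] * (P + ?g * S)"
    unfolding P by (simp only: algebra_simps power2_eq_square)
  ultimately have "3 dvd P ^ 2 - (?g * S) ^ 2"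
    by (metis dvd_mult2)
  \<comment> \<open>Modulo 3, \<open>P\<close> may now be replaced by \<open>?g * S\<close>, and one
    factor \<open>?g\<close> cancels because 3 is prime in the polynomial ring.\<close>
  then have "3 dvd (?g * Q ^ 2 - P ^ 2) + (P ^ 2 - (?g * S) ^ 2)"
    using less.prems by (rule dvd_add [rotated])
  also have "\<dots> = ?g * (Q ^ 2 - ?g * S ^ 2)"
    by (simp only: algebra_simps power2_eq_square)
  finally have "3 dvd ?g \<or> 3 dvd Q ^ 2 - ?g * S ^ 2"
    by (simp only: prime_elem_dvd_mult_iff [OF prime_3_int_poly])
  moreover have "\<not> 3 dvd ?g"
    unfolding three_dvd_int_poly_iff by (auto intro!: exI [of _ 0])
  ultimately have Q: "3 dvd Q ^ 2 - ?g * S ^ 2"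
    by blast
  have "3 dvd S"
  proof (cases "S = 0")
    case False
    have "degree (?g * S) = 2 + degree S"
      using False by (subst degree_mult_eq) auto
    moreover from this have "degree P = degree (?g * S)"
      unfolding P by (intro degree_add_eq_left) (auto intro: le_less_trans [of _ 1])
    ultimately have "degree Q + degree S < degree P + degree Q"
      by simp
    moreover have "3 dvd ?g * S ^ 2 - Q ^ 2"
      using Q by (metis dvd_minus_iff minus_diff_eq)
    ultimately show ?thesis
      using less.hyps by blast
  qed simp
  then have "3 dvd ?g * S ^ 2"
    by (simp add: power2_eq_square del: mult_pCons_left)
  with Q have "3 dvd Q ^ 2"
    using dvd_add [of 3 "Q ^ 2 - ?g * S ^ 2" "?g * S ^ 2"] by simp
  then show ?case
    using prime_elem_dvd_power [OF prime_3_int_poly] by blast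
qed

section \<open>Pade approximants of the generating function\<close>

text \<open>Here \<open>R\<close> is (1 + z^2) Q, so that R C = Q f; the sums are the coefficients
  of R C, and \<open>k0\<close> is the exact order of vanishing of R C - P.\<close>

lemma cantor_pade:
  fixes n :: nat
  obtains R P :: "int poly" and k0 :: nat
  where "degree R \<le> n + 2" "degree P \<le> n" "k0 \<in> {2 * n + 1, 2 * n + 2}"
    "\<And>k. k < k0 \<Longrightarrow> (\<Sum>i\<le>k. coeff R i * int (cantor (k - i))) = coeff P k"
    "(\<Sum>i\<le>k0. coeff R i * int (cantor (k0 - i))) \<noteq> coeff P k0"
proof -
  \<comment> \<open>Any \<open>m\<close> with 3^m > 2n + 3 serves: the polynomial \<open>B\<close>
    then agrees with C in all the coefficients considered.\<close>
  define m where "m = 2 * n + 3"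
  have m: "2 * n + 3 < (3::nat) ^ m"
    unfolding m_def by (rule less_exp [THEN less_le_trans]) (auto intro: power_mono)
  define y g B :: "int poly"
    where "y = monom 1 2" and "g = [:1, 0, 1:]" and "B = cantor_prod m y"
  have g: "1 + y = g"
    by (simp add: y_def g_def monom_altdef numeral_2_eq_2 one_pCons)
  have B: "coeff B k = int (cantor k)" if "k \<le> 2 * n + 3" for k
    using that m by (simp add: B_def y_def coeff_cantor_prod)
  \<comment> \<open>The \<open>n\<close> equations in \<open>n + 1\<close> unknowns say that Q f has
    no terms in degrees n + 1 to 2n.\<close>
  have "\<exists>x. (\<exists>i\<in>{..n}. x i \<noteq> 0)
      \<and> (\<forall>k\<in>{n+1..2*n}. (\<Sum>i\<in>{..n}. coeff (g * B) (k - i) * x i) = 0)"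
    by (rule homogeneous_system_nontrivial) auto
  then obtain x i0 where x: "i0 \<le> n" "x i0 \<noteq> 0"
    "\<And>k. k \<in> {n+1..2*n} \<Longrightarrow> (\<Sum>i\<le>n. coeff (g * B) (k - i) * x i) = 0"
    by fastforce
  define Q0 where "Q0 = Poly (map x [0..<Suc n])"
  have coeff_Q0: "coeff Q0 i = (if i \<le> n then x i else 0)" for i
    unfolding Q0_def coeff_Poly_eq nth_default_def by (auto simp del: upt_Suc)
  have Q0: "Q0 \<noteq> 0"
    using x(1,2) coeff_Q0 [of i0] by auto
  \<comment> \<open>Removing the content keeps the linear equations and ensures that
    \<open>Q\<close> is nonzero modulo 3.\<close>
  define Q where "Q = primitive_part Q0"
  have Q0_eq: "Q0 = smult (content Q0) Q"
    by (simp add: Q_def)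
  have c0: "content Q0 \<noteq> 0"
    using Q0 by simp
  have "content Q = 1"
    using Q0 by (simp add: Q_def)
  then have Q3: "\<not> 3 dvd Q"
    using const_poly_dvd_iff_dvd_content [of 3 Q] by (simp add: numeral_poly)
  have degQ: "degree Q \<le> n"
    unfolding Q_def degree_primitive_part by (rule degree_le) (simp add: coeff_Q0)
  define E where "E = Q * (g * B)"
  have E0: "coeff E k = 0" if "k \<in> {n+1..2*n}" for k
  proof -
    have "coeff (Q0 * (g * B)) k = (\<Sum>i\<le>k. coeff Q0 i * coeff (g * B) (k - i))"
      by (rule coeff_mult)
    also have "\<dots> = (\<Sum>i\<le>n. coeff (g * B) (k - i) * x i)"
      using that by (intro sum.mono_neutral_cong_right) (auto simp: coeff_Q0)
    also have "\<dots> = 0"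
      by (rule x(3) [OF that])
    finally have "content Q0 * coeff E k = 0"
      unfolding E_def by (subst (asm) Q0_eq) simp
    with c0 show ?thesis
      by simp
  qed
  define P where "P = poly_cutoff (n + 1) E"
  have degP: "degree P \<le> n"
    by (rule degree_le) (simp add: P_def coeff_poly_cutoff)
  have P: "coeff P k = coeff E k" if "k \<le> 2 * n" for k
    using that E0 [of k] by (auto simp: P_def coeff_poly_cutoff)
  have P0: "coeff P k = 0" if "k > n" for k
    using that by (simp add: P_def coeff_poly_cutoff)
  \<comment> \<open>If both coefficients vanished, \<open>E\<close> and \<open>P\<close> would agree
    below order 2n + 3, and so would their squares. Modulo 3 the square of \<open>E\<close> is
    \<open>g * Q ^ 2\<close> up to that order.\<close>
  have E_nz: "\<not> (coeff E (2 * n + 1) = 0 \<and> coeff E (2 * n + 2) = 0)"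
  proof
    assume E: "coeff E (2 * n + 1) = 0 \<and> coeff E (2 * n + 2) = 0"
    let ?M = "monom 1 (2 * n + 3) :: int poly"
    have "\<forall>k<2 * n + 3. coeff (E - P) k = 0"
    proof (intro allI impI)
      fix k assume "k < 2 * n + 3"
      then consider "k \<le> 2 * n" | "k = 2 * n + 1" | "k = 2 * n + 2"
        by linarith
      then show "coeff (E - P) k = 0"
        using E P P0 by cases auto
    qed
    then have "?M dvd E - P"
      by (simp add: monom_1_dvd_iff')
    then have "?M dvd (E - P) * (E + P)"
      by simp
    then obtain U where U: "E ^ 2 - P ^ 2 = ?M * U"
      by (auto simp: power2_eq_square algebra_simps elim: dvdE)
    obtain V where V: "g * B ^ 2 - (1 + y ^ 3 ^ m) = 3 * V"
      using cantor_prod_square_mod_3 [of y m] unfolding g B_def by blast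
    have "y ^ 3 ^ m = monom 1 (2 * 3 ^ m)"
      by (simp add: y_def monom_power)
    also have "\<dots> = ?M * monom 1 (2 * 3 ^ m - (2 * n + 3))"
      using m by (simp add: mult_monom)
    finally obtain W where W: "y ^ 3 ^ m = ?M * W"
      by blast
    have "E ^ 2 = Q ^ 2 * g * (g * B ^ 2)"
      by (simp add: E_def power2_eq_square algebra_simps del: mult_pCons_left mult_pCons_right)
    also have "g * B ^ 2 = 1 + ?M * W + 3 * V"
      using V W by (simp add: algebra_simps)
    finally have eq: "g * Q ^ 2 - P ^ 2 = ?M * (U - Q ^ 2 * g * W) + 3 * (- (Q ^ 2 * g * V))"
      using U by (simp add: algebra_simps)
    have deg: "degree (g * Q ^ 2 - P ^ 2) \<le> 2 * n + 2"
    proof (rule degree_diff_le)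
      have "degree (g * Q ^ 2) \<le> degree g + 2 * degree Q"
        by (rule order.trans [OF degree_mult_le]) (simp add: degree_power_eq degree_power_le mult.commute)
      then show "degree (g * Q ^ 2) \<le> 2 * n + 2"
        using degQ by (simp add: g_def)
      have "degree (P ^ 2) \<le> degree P * 2"
        by (rule degree_power_le)
      then show "degree (P ^ 2) \<le> 2 * n + 2"
        using degP by linarith
    qed
    \<comment> \<open>The degree is at most 2n + 2, just below the order of \<open>?M\<close>, so no
      coefficient escapes the congruence.\<close>
    have "3 dvd coeff (g * Q ^ 2 - P ^ 2) k" for k
    proof (cases "k \<le> 2 * n + 2")
      case True
      then have "coeff (g * Q ^ 2 - P ^ 2) k = 3 * coeff (- (Q ^ 2 * g * V)) k"
        unfolding eq by (simp add: coeff_monom_mult numeral_poly)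
      then show ?thesis
        by (metis dvd_triv_left)
    next
      case False
      then have "coeff (g * Q ^ 2 - P ^ 2) k = 0"
        using deg by (intro coeff_eq_0) linarith
      then show ?thesis
        by simp
    qed
    then have "3 dvd g * Q ^ 2 - P ^ 2"
      by (simp add: three_dvd_int_poly_iff)
    with Q3 show False
      unfolding g_def using three_dvd_if_square_mod_3 by blast
  qed
  define k0 where "k0 = (if coeff E (2 * n + 1) = 0 then 2 * n + 2 else 2 * n + 1)"
  have k0: "k0 \<in> {2 * n + 1, 2 * n + 2}" "coeff E k0 \<noteq> 0"
    using E_nz by (auto simp: k0_def)
  have sum_E: "(\<Sum>i\<le>k. coeff (Q * g) i * int (cantor (k - i))) = coeff E k"
    if "k \<le> k0" for k
  proof -
    have "coeff B (k - i) = int (cantor (k - i))" for i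
      using that k0(1) by (intro B) auto
    then show ?thesis
      unfolding E_def mult.assoc [symmetric] coeff_mult [of "Q * g"] by simp
  qed
  show ?thesis
  proof (rule that [of "Q * g" P k0])
    have "degree (Q * g) \<le> degree Q + degree g"
      by (rule degree_mult_le)
    then show "degree (Q * g) \<le> n + 2"
      using degQ by (simp add: g_def)
    show "(\<Sum>i\<le>k. coeff (Q * g) i * int (cantor (k - i))) = coeff P k" if "k < k0" for k
    proof -
      have "coeff E k = coeff P k"
      proof (cases "k \<le> 2 * n")
        case False
        with that k0(1) have "k = 2 * n + 1" "k0 = 2 * n + 2"
          by auto
        then have "coeff E k = 0"
          by (auto simp: k0_def split: if_splits)
        then show ?thesis
          using False by (simp add: P0)
      qed (simp add: P)
      then show ?thesis
        using sum_E that by simp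
    qed
    show "(\<Sum>i\<le>k0. coeff (Q * g) i * int (cantor (k0 - i))) \<noteq> coeff P k0"
      using k0 sum_E [of k0] P0 [of k0] by auto
  qed (use degP k0 in auto)
qed

section \<open>The generating function at real arguments\<close>

definition cantor_gf :: "real \<Rightarrow> real" where
  "cantor_gf x = (\<Sum>k. real (cantor k) * x ^ k)"

lemma summable_cantor:
  fixes x :: real
  assumes "0 \<le> x" "x < 1"
  shows "summable (\<lambda>k. real (cantor k) * x ^ k)"
proof (rule summable_comparison_test')
  show "summable (\<lambda>k. x ^ k)"
    using assms by (intro summable_geometric) simp
  show "norm (real (cantor k) * x ^ k) \<le> x ^ k" for k
    using assms cantor_le_1 [of k] by (simp add: abs_mult mult_left_le_one_le)
qed

lemma cantor_gf_sums:
  assumes "0 \<le> x" "x < 1"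
  shows "(\<lambda>k. real (cantor k) * x ^ k) sums cantor_gf x"
  unfolding cantor_gf_def by (intro summable_sums summable_cantor assms)

lemma cantor_gf_ge_1:
  assumes "0 \<le> x" "x < 1"
  shows "cantor_gf x \<ge> 1"
proof -
  have "(\<Sum>k<1. real (cantor k) * x ^ k) \<le> cantor_gf x"
    unfolding cantor_gf_def using assms by (intro sum_le_suminf summable_cantor) auto
  then show ?thesis
    by (simp add: cantor_0)
qed

lemma cantor_gf_le:
  assumes "0 \<le> x" "x < 1"
  shows "cantor_gf x \<le> 1 / (1 - x)"
proof -
  have "cantor_gf x \<le> (\<Sum>k. x ^ k)"
    unfolding cantor_gf_def
    using assms cantor_le_1
    by (intro suminf_le summable_cantor summable_geometric) (auto simp: mult_left_le_one_le)
  then show ?thesis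
    using assms by (simp add: suminf_geometric)
qed

text \<open>Terms are grouped in threes: index residue 1 contributes nothing, residues 0 and 2 both
  reproduce the series in x^3.\<close>

lemma cantor_gf_cube:
  assumes "0 \<le> x" "x < 1"
  shows "cantor_gf x = (1 + x ^ 2) * cantor_gf (x ^ 3)"
proof -
  have "(\<lambda>n. \<Sum>k\<in>{n*3..<n*3+3}. real (cantor k) * x ^ k) sums cantor_gf x"
    by (rule sums_group [OF cantor_gf_sums [OF assms]]) simp
  moreover have "(\<Sum>k\<in>{n*3..<n*3+3}. real (cantor k) * x ^ k)
      = (1 + x ^ 2) * (real (cantor n) * (x ^ 3) ^ n)" for n
  proof -
    have "{n*3..<n*3+3} = {3 * n, 3 * n + 1, 3 * n + 2}"
      by auto
    then show ?thesis
      using cantor_3n_1 [of n] cantor_3n_2 [of n]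
      by (simp add: cantor_3n power_add power_mult [symmetric] distrib_right power2_eq_square)
  qed
  ultimately have "(\<lambda>n. (1 + x ^ 2) * (real (cantor n) * (x ^ 3) ^ n)) sums cantor_gf x"
    by simp
  moreover have "(\<lambda>n. (1 + x ^ 2) * (real (cantor n) * (x ^ 3) ^ n)) sums
      ((1 + x ^ 2) * cantor_gf (x ^ 3))"
    using assms by (intro sums_mult cantor_gf_sums) (auto simp: power_less_one_iff)
  ultimately show ?thesis
    by (rule sums_unique2)
qed

lemma cantor_gf_iterate:
  assumes "0 \<le> x" "x < 1"
  shows "cantor_gf x = cantor_prod m (x ^ 2) * cantor_gf (x ^ 3 ^ m)"
proof (induction m)
  case 0
  then show ?case
    by (simp add: cantor_prod_def)
next
  case (Suc m)
  have "cantor_gf (x ^ 3 ^ m) = (1 + (x ^ 2) ^ 3 ^ m) * cantor_gf (x ^ 3 ^ Suc m)"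
    using cantor_gf_cube [of "x ^ 3 ^ m"] assms
    by (simp add: power_less_one_iff power_mult [symmetric] mult.commute)
  then show ?case
    by (simp add: Suc.IH cantor_prod_Suc mult.assoc)
qed

text \<open>Every factor is at least 1. For the upper bound, the product is the quotient of C(x) by
  C(x^(3^m)), where the denominator is at least 1 and C(x) is at most 1/(1 - x).\<close>

lemma cantor_prod_bounds:
  fixes x :: real
  assumes "0 \<le> x" "x \<le> 1 / 2"
  shows "1 \<le> cantor_prod m (x ^ 2)" "cantor_prod m (x ^ 2) \<le> 2"
proof -
  show *: "1 \<le> cantor_prod m (x ^ 2)"
    unfolding cantor_prod_def using assms by (intro prod_ge_1) auto
  have "cantor_prod m (x ^ 2) * 1 \<le> cantor_prod m (x ^ 2) * cantor_gf (x ^ 3 ^ m)"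
    using assms * by (intro mult_left_mono cantor_gf_ge_1) (auto simp: power_less_one_iff)
  also have "\<dots> = cantor_gf x"
    using assms by (intro cantor_gf_iterate [symmetric]) auto
  also have "\<dots> \<le> 1 / (1 - x)"
    using assms by (intro cantor_gf_le) auto
  also have "\<dots> \<le> 2"
    using assms by (simp add: field_simps)
  finally show "cantor_prod m (x ^ 2) \<le> 2"
    by simp
qed

text \<open>Since 3^m is 1 plus the sum of 2 * 3^j over j < m, the power of \<open>b\<close>
  supplies each factor with exactly its denominator and leaves one \<open>b\<close> over.\<close>

lemma cantor_prod_inverse_square:
  fixes b :: int
  assumes "b \<noteq> 0"
  shows "real_of_int b ^ 3 ^ m * cantor_prod m ((1 / real_of_int b) ^ 2)
    = real_of_int (b * (\<Prod>j<m. b ^ (2 * 3 ^ j) + 1))"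
proof (induction m)
  case 0
  then show ?case
    by (simp add: cantor_prod_def)
next
  case (Suc m)
  have "real_of_int b ^ 3 ^ Suc m * cantor_prod (Suc m) ((1 / real_of_int b) ^ 2)
      = (real_of_int b ^ 3 ^ m * cantor_prod m ((1 / real_of_int b) ^ 2))
        * (real_of_int b ^ (2 * 3 ^ m) * (1 + ((1 / real_of_int b) ^ 2) ^ 3 ^ m))"
    by (simp add: cantor_prod_Suc power_add [symmetric] mult_ac)
  also have "real_of_int b ^ (2 * 3 ^ m) * (1 + ((1 / real_of_int b) ^ 2) ^ 3 ^ m)
      = real_of_int (b ^ (2 * 3 ^ m) + 1)"
    using assms by (simp add: power_mult [symmetric] power_one_over distrib_left)
  finally show ?case
    by (simp add: Suc.IH mult_ac)
qed

text \<open>With x = 1/b, the shifted series is (C(x) - 1) / x^2, because the first two Cantor terms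
  are 1 and 0.\<close>

lemma eta_d_eq_cantor_gf:
  assumes "b \<ge> 2"
  shows "eta_d b = (real_of_int b ^ 2 + 1) * cantor_gf (1 / real_of_int b) - real_of_int b ^ 2"
proof -
  define x where "x = 1 / real_of_int b"
  define S where "S = cantor_gf x"
  have x: "0 \<le> x" "x < 1" "x \<noteq> 0"
    using assms by (auto simp: x_def)
  have b: "real_of_int b = 1 / x"
    using assms by (simp add: x_def)
  have S: "(\<lambda>k. real (cantor k) * x ^ k) sums S"
    unfolding S_def using x by (intro cantor_gf_sums)
  have "(\<lambda>k. real (cantor (k + 2)) * x ^ (k + 2)) sums
      (S - (\<Sum>k<2. real (cantor k) * x ^ k))"
    by (rule sums_split_initial_segment [OF S])
  also have "(\<Sum>k<2. real (cantor k) * x ^ k) = 1"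
    using cantor_3n_1 [of 0] by (simp add: cantor_0 numeral_2_eq_2)
  finally have "(\<lambda>k. 1 / x ^ 2 * (real (cantor (k + 2)) * x ^ (k + 2))) sums (1 / x ^ 2 * (S - 1))"
    by (rule sums_mult)
  then have "(\<lambda>k. real (cantor (k + 2)) * x ^ k) sums ((S - 1) / x ^ 2)"
    using x by (simp add: power_add power2_eq_square)
  from sums_add [OF S this]
  have "(\<lambda>k. real (cantor_d k) / real_of_int b ^ k) sums (S + (S - 1) / x ^ 2)"
    by (simp add: cantor_d_def b power_divide distrib_right)
  then have "eta_d b = S + (S - 1) / x ^ 2"
    unfolding eta_d_def by (rule sums_unique [symmetric])
  then show ?thesis
    by (simp add: S_def x_def power_divide algebra_simps)
qed

section \<open>Small linear forms in 1 and \<open>eta_d b\<close>\<close>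

lemma power_series_tail_le:
  fixes e :: "nat \<Rightarrow> real"
  assumes s: "(\<lambda>k. e k * x ^ k) sums s"
    and zero: "\<And>k. k < j \<Longrightarrow> e k = 0" and bound: "\<And>k. \<bar>e k\<bar> \<le> M"
    and x: "0 \<le> x" "x \<le> 1 / 2"
  shows "\<bar>s\<bar> \<le> 2 * M * x ^ j"
proof -
  have M: "0 \<le> M"
    using bound [of 0] by linarith
  have "(\<lambda>i. e (i + j) * x ^ (i + j)) sums (s - (\<Sum>k<j. e k * x ^ k))"
    by (rule sums_split_initial_segment [OF s])
  then have s: "(\<lambda>i. e (i + j) * x ^ (i + j)) sums s"
    by (simp add: zero)
  have geo: "(\<lambda>i. M * x ^ j * x ^ i) sums (M * x ^ j * (1 / (1 - x)))"
    using x by (intro sums_mult geometric_sums) auto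
  have "norm (e (i + j) * x ^ (i + j)) \<le> M * x ^ j * x ^ i" for i
    using mult_right_mono [OF bound [of "i + j"], of "x ^ (i + j)"] x
    by (simp add: abs_mult power_add mult_ac)
  then have "\<bar>s\<bar> \<le> M * x ^ j * (1 / (1 - x))"
    using norm_suminf_le [OF _ sums_summable [OF geo], of "\<lambda>i. e (i + j) * x ^ (i + j)"]
      sums_unique [OF s] sums_unique [OF geo] by simp
  also have "\<dots> \<le> M * x ^ j * 2"
    using x M by (intro mult_left_mono) (auto simp: field_simps)
  finally show ?thesis
    by (simp add: mult_ac)
qed

text \<open>Without its leading term the series starts at order \<open>j + 1\<close>, and
  \<open>4 * M * x \<le> 1\<close> makes that rest at most half of x^j.\<close>

lemma power_series_leading_term_le:
  fixes e :: "nat \<Rightarrow> real"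
  assumes s: "(\<lambda>k. e k * x ^ k) sums s"
    and zero: "\<And>k. k < j \<Longrightarrow> e k = 0" and bound: "\<And>k. \<bar>e k\<bar> \<le> M"
    and x: "0 \<le> x" "x \<le> 1 / 2" "4 * M * x \<le> 1" and lead: "1 \<le> \<bar>e j\<bar>"
  shows "x ^ j / 2 \<le> \<bar>s\<bar>"
proof -
  have "(\<lambda>k. e k * x ^ k - (if k = j then e k * x ^ k else 0)) sums (s - e j * x ^ j)"
    by (intro sums_diff s sums_single)
  also have "(\<lambda>k. e k * x ^ k - (if k = j then e k * x ^ k else 0))
      = (\<lambda>k. (e(j := 0)) k * x ^ k)"
    by auto
  finally have "\<bar>s - e j * x ^ j\<bar> \<le> 2 * M * x ^ Suc j"
  proof (rule power_series_tail_le)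
    show "\<bar>(e(j := 0)) k\<bar> \<le> M" for k
      using bound [of k] by auto
    show "(e(j := 0)) k = 0" if "k < Suc j" for k
      using that zero [of k] by auto
  qed (use x in auto)
  also have "\<dots> = (2 * M * x) * x ^ j"
    by simp
  also have "\<dots> \<le> (1 / 2) * x ^ j"
    using x by (intro mult_right_mono) auto
  finally have "\<bar>s - e j * x ^ j\<bar> \<le> x ^ j / 2"
    by simp
  moreover have "1 * x ^ j \<le> \<bar>e j\<bar> * x ^ j"
    using lead x by (intro mult_right_mono) auto
  then have "x ^ j \<le> \<bar>e j * x ^ j\<bar>"
    using x by (simp add: abs_mult)
  ultimately show ?thesis
    by linarith
qed

text \<open>The form R C - P for fixed \<open>n\<close> is evaluated at 1/X with X = b^(3^m). Its
  coefficients do not depend on \<open>m\<close>, so for large \<open>m\<close> every constant is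
  absorbed by one factor X.\<close>

lemma eta_d_linear_forms:
  fixes b :: int
  assumes "b \<ge> 2"
  shows "\<exists>m0. \<forall>m\<ge>m0. \<exists>u v :: int.
    \<bar>real_of_int u\<bar> \<le> (real_of_int b ^ 3 ^ m) ^ (n + 4) \<and>
    1 \<le> (real_of_int b ^ 3 ^ m) ^ n * \<bar>real_of_int u * eta_d b - real_of_int v\<bar> \<and>
    (real_of_int b ^ 3 ^ m) ^ n * \<bar>real_of_int u * eta_d b - real_of_int v\<bar> \<le> (real_of_int b ^ 3 ^ m) ^ 3"
proof -
  obtain R P :: "int poly" and k0 :: nat
    where deg: "degree R \<le> n + 2" "degree P \<le> n" and k0: "k0 \<in> {2 * n + 1, 2 * n + 2}"
    and below: "\<And>k. k < k0 \<Longrightarrow> (\<Sum>i\<le>k. coeff R i * int (cantor (k - i))) = coeff P k"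
    and at: "(\<Sum>i\<le>k0. coeff R i * int (cantor (k0 - i))) \<noteq> coeff P k0"
    using cantor_pade [of n] by blast
  define r p where "r i = real_of_int (coeff R i)" and "p i = real_of_int (coeff P i)" for i
  have r0: "r i = 0" if "i > n + 2" for i
    using that deg by (simp add: r_def coeff_eq_0)
  have p0: "p i = 0" if "i > n" for i
    using that deg by (simp add: p_def coeff_eq_0)
  \<comment> \<open>\<open>M\<close> bounds all coefficients \<open>e k\<close>, since Cantor terms
    are at most 1, and also |R(w)| for 0 \<le> w \<le> 1; the summand 1 gives M \<ge> 1.\<close>
  define M where "M = 1 + (\<Sum>i\<le>n+2. \<bar>r i\<bar>) + (\<Sum>i\<le>n. \<bar>p i\<bar>)"
  have M1: "1 \<le> M"
    unfolding M_def by (intro add_increasing2 sum_nonneg) auto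
  define e where "e k = (\<Sum>i\<le>k. r i * real (cantor (k - i))) - p k" for k
  have e_int: "e k = real_of_int ((\<Sum>i\<le>k. coeff R i * int (cantor (k - i))) - coeff P k)" for k
    by (simp add: e_def r_def p_def)
  have e_zero: "e k = 0" if "k < k0" for k
    using below [OF that] unfolding e_int by simp
  have e_lead: "1 \<le> \<bar>e k0\<bar>"
    using at unfolding e_int of_int_abs [symmetric] by linarith
  have e_bound: "\<bar>e k\<bar> \<le> M" for k
  proof -
    have "\<bar>\<Sum>i\<le>k. r i * real (cantor (k - i))\<bar> \<le> (\<Sum>i\<le>k. \<bar>r i\<bar>)"
      using cantor_le_1 by (intro sum_abs [THEN order.trans] sum_mono) (auto simp: abs_mult mult_left_le)
    also have "\<dots> \<le> (\<Sum>i\<in>{..k}\<union>{..n+2}. \<bar>r i\<bar>)"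
      by (intro sum_mono2) auto
    also have "\<dots> = (\<Sum>i\<le>n+2. \<bar>r i\<bar>)"
      using r0 by (intro sum.mono_neutral_right) auto
    finally have 1: "\<bar>\<Sum>i\<le>k. r i * real (cantor (k - i))\<bar> \<le> (\<Sum>i\<le>n+2. \<bar>r i\<bar>)" .
    have 2: "\<bar>p k\<bar> \<le> (\<Sum>i\<le>n. \<bar>p i\<bar>)"
      using p0 [of k] by (cases "k \<le> n") (auto intro: member_le_sum sum_nonneg)
    show ?thesis
      using 1 2 unfolding e_def M_def by linarith
  qed
  define B where "B = real_of_int b"
  have B: "2 \<le> B"
    using assms by (simp add: B_def)
  define \<beta> where "\<beta> = cantor_gf (1 / B)"
  have eta: "eta_d b = (B ^ 2 + 1) * \<beta> - B ^ 2"
    unfolding B_def \<beta>_def by (rule eta_d_eq_cantor_gf [OF assms])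
  define m0 where "m0 = nat \<lceil>4 * M * (B ^ 2 + 1)\<rceil>"
  show ?thesis
  proof (intro exI [of _ m0] allI impI)
    fix m assume m: "m \<ge> m0"
    define N where "N = b ^ 3 ^ m"
    define X where "X = real_of_int N"
    have X_eq: "X = B ^ 3 ^ m"
      by (simp add: X_def N_def B_def)
    have "4 * M * (B ^ 2 + 1) \<le> real m"
      using m unfolding m0_def by linarith
    also have "real m \<le> 2 ^ m"
      using of_nat_less_two_power [of m, where 'a = real] by linarith
    also have "\<dots> \<le> 2 ^ 3 ^ m"
      by (intro power_increasing) (auto intro: less_imp_le [OF less_exp [of m, THEN less_le_trans]] power_mono)
    also have "\<dots> \<le> X"
      unfolding X_eq using B by (intro power_mono) auto
    finally have X_ge: "4 * M * (B ^ 2 + 1) \<le> X" .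
    have "4 * M * 1 \<le> 4 * M * (B ^ 2 + 1)"
      using M1 by (intro mult_left_mono) auto
    with X_ge have XM: "4 * M \<le> X"
      by linarith
    with M1 have X4: "4 \<le> X"
      by linarith
    define w where "w = 1 / X"
    have w: "0 \<le> w" "w \<le> 1 / 2" "4 * M * w \<le> 1" "w < 1"
      using X4 XM by (auto simp: w_def field_simps)
    have w_eq: "w = (1 / B) ^ 3 ^ m"
      by (simp add: w_def X_eq power_one_over)
    define s where "s = (\<Sum>i\<le>n+2. r i * w ^ i) * cantor_gf w - (\<Sum>i\<le>n. p i * w ^ i)"
    have s: "(\<lambda>k. e k * w ^ k) sums s"
    proof -
      have R: "(\<lambda>i. r i * w ^ i) sums (\<Sum>i\<le>n+2. r i * w ^ i)"
        by (rule sums_finite) (auto simp: r0)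
      have P: "(\<lambda>i. p i * w ^ i) sums (\<Sum>i\<le>n. p i * w ^ i)"
        by (rule sums_finite) (auto simp: p0)
      have "summable (\<lambda>i. norm (r i * w ^ i))"
        by (rule summable_finite [of "{..n+2}"]) (auto simp: r0)
      moreover have "summable (\<lambda>k. norm (real (cantor k) * w ^ k))"
        using summable_cantor [of w] w by (simp add: abs_mult)
      ultimately have "(\<lambda>k. \<Sum>i\<le>k. r i * w ^ i * (real (cantor (k - i)) * w ^ (k - i))) sums
          ((\<Sum>i. r i * w ^ i) * (\<Sum>k. real (cantor k) * w ^ k))"
        by (rule Cauchy_product_sums)
      from sums_diff [OF this P]
      have "(\<lambda>k. (\<Sum>i\<le>k. r i * w ^ i * (real (cantor (k - i)) * w ^ (k - i))) - p k * w ^ k) sums s"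
        unfolding s_def cantor_gf_def sums_unique [OF R, symmetric] .
      moreover have "(\<Sum>i\<le>k. r i * w ^ i * (real (cantor (k - i)) * w ^ (k - i))) - p k * w ^ k = e k * w ^ k" for k
      proof -
        have "(\<Sum>i\<le>k. r i * w ^ i * (real (cantor (k - i)) * w ^ (k - i)))
            = (\<Sum>i\<le>k. r i * real (cantor (k - i)) * w ^ k)"
        proof (rule sum.cong [OF refl])
          fix i assume "i \<in> {..k}"
          then have "w ^ k = w ^ i * w ^ (k - i)"
            by (simp flip: power_add)
          then show "r i * w ^ i * (real (cantor (k - i)) * w ^ (k - i)) = r i * real (cantor (k - i)) * w ^ k"
            by simp
        qed
        then show ?thesis
          by (simp add: e_def left_diff_distrib sum_distrib_right)
      qed
      ultimately show ?thesis
        by simp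
    qed
    have s_le: "\<bar>s\<bar> \<le> 2 * M * w ^ k0"
      using s e_zero e_bound w by (intro power_series_tail_le)
    have s_ge: "w ^ k0 / 2 \<le> \<bar>s\<bar>"
      using s e_zero e_bound w(1-3) e_lead by (rule power_series_leading_term_le)
    define \<rho> where "\<rho> = cantor_prod m ((1 / B) ^ 2)"
    have \<rho>_bounds: "1 \<le> \<rho>" "\<rho> \<le> 2"
      unfolding \<rho>_def using B by (intro cantor_prod_bounds; simp add: field_simps)+
    have \<beta>_eq: "\<beta> = \<rho> * cantor_gf w"
      unfolding \<beta>_def \<rho>_def w_eq using B by (intro cantor_gf_iterate) auto
    \<comment> \<open>This integer is \<open>X * \<rho>\<close>, which makes the factor
      \<open>\<rho>\<close> in front of P(w) integral.\<close>
    define A where "A = b * (\<Prod>j<m. b ^ (2 * 3 ^ j) + 1)"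
    have A: "real_of_int A = X * \<rho>"
      using cantor_prod_inverse_square [of b m] assms
      by (simp only: A_def X_eq \<rho>_def B_def)
    \<comment> \<open>The power X^(n + 2) clears the denominators of R(w); \<open>P'\<close> uses
      the same power to keep both parts of the form on one scale.\<close>
    define R' where "R' = (\<Sum>i\<le>n+2. coeff R i * N ^ (n + 2 - i))"
    define P' where "P' = (\<Sum>i\<le>n. coeff P i * N ^ (n + 2 - i))"
    have wpow: "X ^ (n + 2) * w ^ i = X ^ (n + 2 - i)" if "i \<le> n + 2" for i
      using that X4 power_add [of X "n + 2 - i" i] by (simp add: w_def power_one_over)
    have R': "real_of_int R' = X ^ (n + 2) * (\<Sum>i\<le>n+2. r i * w ^ i)"
      unfolding R'_def sum_distrib_left of_int_sum
      by (intro sum.cong refl) (use wpow in \<open>simp add: r_def X_def mult_ac\<close>)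
    have P': "real_of_int P' = X ^ (n + 2) * (\<Sum>i\<le>n. p i * w ^ i)"
      unfolding P'_def sum_distrib_left of_int_sum
      by (intro sum.cong refl) (use wpow in \<open>simp add: p_def X_def mult_ac\<close>)
    \<comment> \<open>The term with \<open>b ^ 2\<close> in \<open>v\<close> cancels the
      \<open>- B ^ 2\<close> of \<open>eta\<close>; what remains is (B^2 + 1) X \<rho> (R' C(w) -
      P').\<close>
    define u where "u = R' * N"
    define v where "v = (b ^ 2 + 1) * A * P' - b ^ 2 * R' * N"
    have L: "real_of_int u * eta_d b - real_of_int v = (B ^ 2 + 1) * X ^ (n + 3) * \<rho> * s"
    proof -
      have "real_of_int u * eta_d b - real_of_int v
          = (B ^ 2 + 1) * (real_of_int R' * X * \<beta> - X * \<rho> * real_of_int P')"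
        unfolding u_def v_def eta
        by (simp add: A B_def [symmetric] X_def [symmetric]) (simp add: algebra_simps)
      also have "\<dots> = (B ^ 2 + 1) * X ^ (n + 3) * \<rho> * s"
        unfolding R' P' \<beta>_eq s_def by (simp add: algebra_simps power3_eq_cube power2_eq_square power_add)
      finally show ?thesis .
    qed
    have "\<bar>\<Sum>i\<le>n+2. r i * w ^ i\<bar> \<le> (\<Sum>i\<le>n+2. \<bar>r i\<bar>)"
      using w by (intro sum_abs [THEN order.trans] sum_mono)
        (auto simp: abs_mult intro!: mult_left_le power_le_one)
    also have "\<dots> \<le> M"
      unfolding M_def by (intro add_increasing add_increasing2 sum_nonneg) auto
    also have "M \<le> X"
      using XM M1 by linarith
    finally have "X ^ (n + 3) * \<bar>\<Sum>i\<le>n+2. r i * w ^ i\<bar> \<le> X ^ (n + 3) * X"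
      using X4 by (intro mult_left_mono) auto
    moreover have "\<bar>real_of_int u\<bar> = X ^ (n + 3) * \<bar>\<Sum>i\<le>n+2. r i * w ^ i\<bar>"
      using X4 by (simp add: u_def R' X_def [symmetric] abs_mult power_add power3_eq_cube power2_eq_square)
    ultimately have u: "\<bar>real_of_int u\<bar> \<le> X ^ (n + 4)"
      by (simp add: power_add numeral_eq_Suc mult_ac)
    have absL: "X ^ n * \<bar>real_of_int u * eta_d b - real_of_int v\<bar>
        = (B ^ 2 + 1) * \<rho> * (X ^ (2 * n + 3) * \<bar>s\<bar>)"
    proof -
      have "X ^ (2 * n + 3) = X ^ n * X ^ (n + 3)"
        by (simp add: power_add [symmetric])
      moreover have "\<bar>(B ^ 2 + 1) * X ^ (n + 3) * \<rho> * s\<bar> = (B ^ 2 + 1) * X ^ (n + 3) * \<rho> * \<bar>s\<bar>"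
        using X4 \<rho>_bounds by (simp add: abs_mult)
      ultimately show ?thesis
        unfolding L by (simp only: mult_ac)
    qed
    have wX: "X * w = 1"
      using X4 by (simp add: w_def)
    have wX': "X ^ j * w ^ j = 1" for j
      using wX by (simp add: power_mult_distrib [symmetric])
    \<comment> \<open>The upper estimate uses k0 \<ge> 2n + 1, the lower one further down k0 \<le>
      2n + 2, which still leaves a spare factor X.\<close>
    have s_X: "X ^ (2 * n + 3) * \<bar>s\<bar> \<le> 2 * M * X ^ 2"
    proof -
      have "w ^ k0 \<le> w ^ (2 * n + 1)"
        using k0 w by (intro power_decreasing) auto
      then have "2 * M * w ^ k0 \<le> 2 * M * w ^ (2 * n + 1)"
        using M1 by (intro mult_left_mono) auto
      with s_le have "\<bar>s\<bar> \<le> 2 * M * w ^ (2 * n + 1)"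
        by linarith
      then have "X ^ (2 * n + 3) * \<bar>s\<bar> \<le> X ^ (2 * n + 3) * (2 * M * w ^ (2 * n + 1))"
        using X4 by (intro mult_left_mono) auto
      also have "\<dots> = 2 * M * X ^ 2 * (X ^ (2 * n + 1) * w ^ (2 * n + 1))"
        by (simp add: numeral_eq_Suc)
      finally show ?thesis
        by (simp only: wX' mult_1_right)
    qed
    have "(B ^ 2 + 1) * \<rho> \<le> (B ^ 2 + 1) * 2"
      using \<rho>_bounds by (intro mult_left_mono) auto
    from this s_X have "(B ^ 2 + 1) * \<rho> * (X ^ (2 * n + 3) * \<bar>s\<bar>) \<le> (B ^ 2 + 1) * 2 * (2 * M * X ^ 2)"
      by (rule mult_mono) (use X4 in auto)
    also have "\<dots> = 4 * M * (B ^ 2 + 1) * X ^ 2"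
      by simp
    also have "\<dots> \<le> X * X ^ 2"
      using X_ge by (intro mult_right_mono) auto
    finally have upper: "X ^ n * \<bar>real_of_int u * eta_d b - real_of_int v\<bar> \<le> X ^ 3"
      unfolding absL by (simp add: power3_eq_cube power2_eq_square)
    have "2 \<le> X ^ (2 * n + 3) * (2 * \<bar>s\<bar>)"
    proof -
      have "w ^ (2 * n + 2) \<le> w ^ k0"
        using k0 w by (intro power_decreasing) auto
      with s_ge have "w ^ (2 * n + 2) \<le> 2 * \<bar>s\<bar>"
        by linarith
      then have "X ^ (2 * n + 3) * w ^ (2 * n + 2) \<le> X ^ (2 * n + 3) * (2 * \<bar>s\<bar>)"
        using X4 by (intro mult_left_mono) auto
      moreover have "X ^ (2 * n + 3) * w ^ (2 * n + 2) = X * (X ^ (2 * n + 2) * w ^ (2 * n + 2))"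
        by (simp add: numeral_eq_Suc)
      then have "X ^ (2 * n + 3) * w ^ (2 * n + 2) = X"
        by (simp only: wX' mult_1_right)
      ultimately show ?thesis
        using X4 by linarith
    qed
    then have "1 * 1 * 1 \<le> (B ^ 2 + 1) * \<rho> * (X ^ (2 * n + 3) * \<bar>s\<bar>)"
      using \<rho>_bounds by (intro mult_mono) auto
    then have lower: "1 \<le> X ^ n * \<bar>real_of_int u * eta_d b - real_of_int v\<bar>"
      unfolding absL by simp
    show "\<exists>u v :: int.
      \<bar>real_of_int u\<bar> \<le> (real_of_int b ^ 3 ^ m) ^ (n + 4) \<and>
      1 \<le> (real_of_int b ^ 3 ^ m) ^ n * \<bar>real_of_int u * eta_d b - real_of_int v\<bar> \<and>
      (real_of_int b ^ 3 ^ m) ^ n * \<bar>real_of_int u * eta_d b - real_of_int v\<bar> \<le> (real_of_int b ^ 3 ^ m) ^ 3"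
      using u lower upper unfolding X_eq B_def by blast
  qed
qed

section \<open>Lower bounds for rational approximations\<close>

text \<open>The index just before the first value above \<open>q\<close> works, so no monotonicity
  enters.\<close>

lemma ex_crossing_index:
  fixes g :: "nat \<Rightarrow> nat"
  assumes "g a \<le> q" "q < g (a + k)"
  obtains i where "i < k" "g (a + i) \<le> q" "q < g (a + Suc i)"
  using ex_least_nat_less [of "\<lambda>i. q < g (a + i)" k] assms by force

text \<open>For a form \<Lambda> = u eta - v, u (q eta - p) is q \<Lambda> plus the integer q v - u
  p. If that integer is zero, the lower bound on \<Lambda> applies; otherwise it dominates q
  \<Lambda>.\<close>

lemma eta_d_approximation_bound:
  fixes b :: int and K :: nat
  assumes b: "b \<ge> 2" and K: "K > 0"
  shows "\<exists>q0. \<forall>(p :: int) (q :: nat). q \<ge> q0 \<longrightarrow>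
    1 / real q powr (2 + 14 / real K) \<le> \<bar>eta_d b - real_of_int p / real q\<bar>"
proof -
  define B where "B = real_of_int b"
  have B: "2 \<le> B"
    using b by (simp add: B_def)
  obtain f where f: "\<And>n m. f n \<le> m \<Longrightarrow> \<exists>u v :: int.
    \<bar>real_of_int u\<bar> \<le> (B ^ 3 ^ m) ^ (n + 4) \<and>
    1 \<le> (B ^ 3 ^ m) ^ n * \<bar>real_of_int u * eta_d b - real_of_int v\<bar> \<and>
    (B ^ 3 ^ m) ^ n * \<bar>real_of_int u * eta_d b - real_of_int v\<bar> \<le> (B ^ 3 ^ m) ^ 3"
    using eta_d_linear_forms [OF b] unfolding B_def by metis
  \<comment> \<open>A common threshold for all forms used: below, n = t + 5 with K \<le> t <
    3K.\<close>
  define M where "M = (\<Sum>n\<le>3*K+5. f n)"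
  define N where "N m = nat b ^ 3 ^ m" for m
  have N: "real (N m) = B ^ 3 ^ m" for m
    using b by (simp add: N_def B_def)
  have N_Suc: "N (Suc m) = N m ^ 3" for m
    by (simp add: N_def power_mult [symmetric] mult.commute)
  show ?thesis
  proof (intro exI [of _ "N M ^ K"] allI impI)
    fix p :: int and q :: nat
    assume q: "N M ^ K \<le> q"
    have "q < 2 ^ q"
      by (rule less_exp)
    also have "2 ^ q \<le> nat b ^ q"
      using b by (intro power_mono) auto
    also have "\<dots> \<le> nat b ^ (3 ^ (M + q) * K)"
    proof (intro power_increasing)
      have "q \<le> 3 ^ q"
        by (rule less_imp_le, rule less_exp [THEN less_le_trans]) (simp add: power_mono)
      also have "3 ^ q \<le> (3::nat) ^ (M + q)"
        by (intro power_increasing) auto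
      also have "\<dots> \<le> 3 ^ (M + q) * K"
        using K by simp
      finally show "q \<le> 3 ^ (M + q) * K" .
    qed (use b in auto)
    finally have "q < N (M + q) ^ K"
      by (simp add: N_def power_mult)
    \<comment> \<open>First \<open>m\<close> is located, then the exponent: N(m + 1) = N(m)^3 makes
      the range for \<open>q\<close> run from N(m)^K to N(m)^(3K), which is cut at the powers of
      N(m).\<close>
    with q obtain i where i: "N (M + i) ^ K \<le> q" "q < N (M + Suc i) ^ K"
      using ex_crossing_index [of "\<lambda>m. N m ^ K" M q q] by blast
    define m where "m = M + i"
    have m: "M \<le> m" "N m ^ K \<le> q" "q < N m ^ (K + 2 * K)"
      using i by (simp_all add: m_def N_Suc power_mult [symmetric])
    from m(2,3) obtain j where j: "j < 2 * K" "N m ^ (K + j) \<le> q" "q < N m ^ (K + Suc j)"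
      using ex_crossing_index [of "\<lambda>t. N m ^ t" K q "2 * K"] by blast
    define t where "t = K + j"
    \<comment> \<open>The forms with \<open>n = t + 5\<close> satisfy \<open>q |u eta_d b - v| \<le> 1/2\<close>, with \<open>|u|\<close> still within \<open>X^9\<close> of \<open>q\<close>.\<close>
    define X where "X = B ^ 3 ^ m"
    have "real (N m ^ t) \<le> real q" "real q < real (N m ^ (t + 1))"
      using j by (simp_all only: t_def of_nat_le_iff of_nat_less_iff) simp
    then have Xq: "X ^ t \<le> real q" "real q < X ^ (t + 1)"
      by (simp_all add: N X_def)
    have "B ^ 1 \<le> X"
      unfolding X_def using B by (intro power_increasing) auto
    then have X: "2 \<le> X"
      using B by simp
    have "f (t + 5) \<le> M"
      unfolding M_def using j(1) by (intro member_le_sum) (auto simp: t_def)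
    with f [of "t + 5" m] m(1) obtain u v :: int where
      u: "\<bar>real_of_int u\<bar> \<le> X ^ (t + 9)"
      and L: "1 \<le> X ^ (t + 5) * \<bar>real_of_int u * eta_d b - real_of_int v\<bar>"
        "X ^ (t + 5) * \<bar>real_of_int u * eta_d b - real_of_int v\<bar> \<le> X ^ 3"
      unfolding X_def [symmetric] by (auto simp: add.assoc)
    define \<Lambda> where "\<Lambda> = real_of_int u * eta_d b - real_of_int v"
    define \<delta> where "\<delta> = real q * eta_d b - real_of_int p"
    have comb: "real_of_int u * \<delta> = real q * \<Lambda> + real_of_int (int q * v - u * p)"
      by (simp add: \<Lambda>_def \<delta>_def algebra_simps)
    have u\<delta>: "\<bar>real_of_int u * \<delta>\<bar> \<le> X ^ (t + 9) * \<bar>\<delta>\<bar>"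
      using u by (simp add: abs_mult mult_right_mono)
    \<comment> \<open>The exponent 14 is 9 + 5: t + 9 bounds \<open>u\<close>, and 5 is the loss in
      the lower bound on \<Lambda> against q \<ge> X^t. The second case loses only a factor
      2.\<close>
    have main: "1 \<le> X ^ (t + 14) * \<bar>\<delta>\<bar>"
    proof (cases "int q * v = u * p")
      case True
      have "1 \<le> X ^ 5 * (X ^ t * \<bar>\<Lambda>\<bar>)"
        using L(1) by (simp add: \<Lambda>_def power_add mult_ac)
      also have "\<dots> \<le> X ^ 5 * (real q * \<bar>\<Lambda>\<bar>)"
        using Xq X by (intro mult_left_mono mult_right_mono) auto
      also have "real q * \<bar>\<Lambda>\<bar> = \<bar>real_of_int u * \<delta>\<bar>"
        unfolding comb using True by (simp add: abs_mult)
      also have "X ^ 5 * \<dots> \<le> X ^ 5 * (X ^ (t + 9) * \<bar>\<delta>\<bar>)"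
        using u\<delta> X by (intro mult_left_mono) auto
      also have "\<dots> = X ^ (t + 14) * \<bar>\<delta>\<bar>"
        by (simp add: mult.assoc [symmetric] power_add [symmetric] add.commute)
      finally show ?thesis .
    next
      case False
      have "X ^ (t + 5) = X ^ 3 * X ^ (t + 2)"
        by (simp add: power_add numeral_eq_Suc)
      then have "X ^ 3 * (X ^ (t + 2) * \<bar>\<Lambda>\<bar>) \<le> X ^ 3 * 1"
        using L(2) by (simp only: \<Lambda>_def mult.assoc mult_1_right)
      then have "X ^ (t + 2) * \<bar>\<Lambda>\<bar> \<le> 1"
        using X by (simp only: mult_le_cancel_left_pos zero_less_power)
      moreover have "X * (real q * \<bar>\<Lambda>\<bar>) \<le> X * (X ^ (t + 1) * \<bar>\<Lambda>\<bar>)"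
        using X Xq by (intro mult_left_mono mult_right_mono) auto
      moreover have "2 * (real q * \<bar>\<Lambda>\<bar>) \<le> X * (real q * \<bar>\<Lambda>\<bar>)"
        using X by (intro mult_right_mono) auto
      ultimately have "2 * \<bar>real q * \<Lambda>\<bar> \<le> 1"
        by (simp add: abs_mult mult.assoc)
      moreover have "1 \<le> \<bar>real_of_int (int q * v - u * p)\<bar>"
        using False unfolding of_int_abs [symmetric] by linarith
      moreover have "1 \<le> 2 * \<bar>x + y\<bar>" if "2 * \<bar>x\<bar> \<le> 1" "1 \<le> \<bar>y\<bar>" for x y :: real
        using that abs_triangle_ineq2 [of y "- x"] by (simp add: add.commute)
      ultimately have "1 \<le> 2 * \<bar>real_of_int u * \<delta>\<bar>"
        unfolding comb by blast
      also have "\<dots> \<le> 2 * (X ^ (t + 9) * \<bar>\<delta>\<bar>)"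
        using u\<delta> by simp
      also have "\<dots> \<le> X ^ 5 * (X ^ (t + 9) * \<bar>\<delta>\<bar>)"
        using X self_le_power [of X 5] by (intro mult_right_mono) auto
      also have "\<dots> = X ^ (t + 14) * \<bar>\<delta>\<bar>"
        by (simp add: mult.assoc [symmetric] power_add [symmetric] add.commute)
      finally show ?thesis .
    qed
    have q0: "0 < real q"
      using Xq(1) X by (intro less_le_trans [OF _ Xq(1)]) auto
    \<comment> \<open>Since t \<ge> K, X is at most q^(1/K), which turns the loss X^14 into
      q^(14/K).\<close>
    have "X ^ K \<le> real q"
      using m(2) by (metis N X_def of_nat_le_iff of_nat_power)
    then have "(X ^ K) powr (1 / real K) \<le> real q powr (1 / real K)"
      using X by (intro powr_mono2) auto
    then have "X \<le> real q powr (1 / real K)"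
      using X K by (simp add: powr_realpow [symmetric] powr_powr)
    then have "X ^ 14 \<le> (real q powr (1 / real K)) ^ 14"
      using X by (intro power_mono) auto
    also have "\<dots> = real q powr (14 / real K)"
      using q0 powr_power [of "real q" "1 / real K" 14] by simp
    finally have X14: "X ^ 14 \<le> real q powr (14 / real K)" .
    have "X ^ (t + 14) \<le> real q * real q powr (14 / real K)"
      unfolding power_add using X14 Xq X by (intro mult_mono) auto
    then have "X ^ (t + 14) * \<bar>\<delta>\<bar> \<le> real q * real q powr (14 / real K) * \<bar>\<delta>\<bar>"
      by (intro mult_right_mono) auto
    with main have le: "1 \<le> real q * real q powr (14 / real K) * \<bar>\<delta>\<bar>"
      by linarith
    have "eta_d b - real_of_int p / real q = \<delta> / real q"
      using q0 by (simp add: \<delta>_def field_simps)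
    then have "\<bar>eta_d b - real_of_int p / real q\<bar> = \<bar>\<delta>\<bar> / real q"
      by (simp add: abs_divide)
    moreover have "real q powr (2 + 14 / real K) = real q ^ 2 * real q powr (14 / real K)"
      using q0 by (simp add: powr_add powr_numeral)
    ultimately show "1 / real q powr (2 + 14 / real K) \<le> \<bar>eta_d b - real_of_int p / real q\<bar>"
      using le q0 by (simp add: field_simps power2_eq_square)
  qed
qed

section \<open>Irrationality and the exponent\<close>

text \<open>A rational value a/c has representations with arbitrarily large denominators, at
  distance 0, against the positive lower bound.\<close>

lemma eta_d_irrational:
  assumes "b \<ge> 2"
  shows "eta_d b \<notin> \<rat>"
proof
  assume "eta_d b \<in> \<rat>"
  then obtain a c :: int where ac: "eta_d b = real_of_int a / real_of_int c" "c > 0"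
    by (meson Rats_cases')
  obtain q0 where q0: "\<And>(p :: int) (q :: nat). q \<ge> q0 \<Longrightarrow>
      1 / real q powr (2 + 14 / real 1) \<le> \<bar>eta_d b - real_of_int p / real q\<bar>"
    using eta_d_approximation_bound [OF assms, of 1] by auto
  define q where "q = nat c * Suc q0"
  have "q0 \<le> q"
    using ac(2) by (cases "nat c") (auto simp: q_def)
  moreover have "real q = real_of_int c * real (Suc q0)"
    using ac(2) unfolding q_def of_nat_mult by simp
  then have "eta_d b = real_of_int (a * int (Suc q0)) / real q"
    using ac(1) by (simp del: of_nat_Suc)
  moreover have "0 < real q"
    using ac(2) by (simp add: q_def del: mult_Suc_right of_nat_Suc)
  ultimately show False
    using q0 [of q "a * int (Suc q0)"] by (simp add: not_le)
qed

theorem corollary2: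
  fixes b :: int
  assumes "b \<ge> 2"
  shows "eta_d b \<notin> \<rat> \<and> irrationality_exponent (eta_d b) = 2"
proof
  show irr: "eta_d b \<notin> \<rat>"
    by (rule eta_d_irrational [OF assms])
  define S where "S \<mu> = {(p :: int, q :: nat). q \<ge> 1 \<and>
    \<bar>eta_d b - real_of_int p / real q\<bar> < 1 / real q powr \<mu>}" for \<mu>
  \<comment> \<open>Dirichlet's approximation theorem for irrational numbers; only the type of the
    denominators changes.\<close>
  have "infinite (S 2)"
  proof -
    let ?h = "\<lambda>(p :: int, q :: int). (p, nat q)"
    have "infinite (approx_set (eta_d b))"
      using irr rational_iff_finite_approx_set by blast
    moreover have "inj_on ?h (approx_set (eta_d b))"
      by (auto simp: inj_on_def approx_set_def)
    ultimately have "infinite (?h ` approx_set (eta_d b))"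
      by (simp add: finite_image_iff)
    moreover have "?h ` approx_set (eta_d b) \<subseteq> S 2"
      by (auto simp: S_def approx_set_def powr_numeral)
    ultimately show ?thesis
      using finite_subset by blast
  qed
  moreover have "finite (S \<mu>)" if "\<mu> > 2" for \<mu>
  proof -
    obtain K where K: "14 / (\<mu> - 2) < real K"
      using reals_Archimedean2 by blast
    have "0 < 14 / (\<mu> - 2)"
      using that by simp
    then have K0: "0 < real K"
      using K by linarith
    have K\<mu>: "2 + 14 / real K \<le> \<mu>"
      using K K0 that by (simp add: field_simps)
    obtain q0 where q0: "\<And>(p :: int) (q :: nat). q \<ge> q0 \<Longrightarrow>
        1 / real q powr (2 + 14 / real K) \<le> \<bar>eta_d b - real_of_int p / real q\<bar>"
      using eta_d_approximation_bound [OF assms, of K] K0 by auto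
    \<comment> \<open>With q < q0 and the distance below 1, this bounds the numerators, so only
      finitely many pairs remain.\<close>
    define c where "c = \<lceil>real q0 * (\<bar>eta_d b\<bar> + 1)\<rceil>"
    have "S \<mu> \<subseteq> {-c..c} \<times> {..<q0}"
    proof clarify
      fix p q assume "(p, q) \<in> S \<mu>"
      then have q: "1 \<le> q" and less: "\<bar>eta_d b - real_of_int p / real q\<bar> < 1 / real q powr \<mu>"
        by (auto simp: S_def)
      have qq0: "q < q0"
      proof (rule ccontr)
        assume "\<not> q < q0"
        then have "1 / real q powr (2 + 14 / real K) < 1 / real q powr \<mu>"
          using q0 [of q p] less by simp
        moreover have "real q powr (2 + 14 / real K) \<le> real q powr \<mu>"
          using q K\<mu> by (intro powr_mono) auto
        ultimately show False
          using q by (simp add: field_simps)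
      qed
      have "1 / real q powr \<mu> \<le> 1"
        using q that by (simp add: ge_one_powr_ge_zero)
      with less have "\<bar>real_of_int p / real q\<bar> \<le> \<bar>eta_d b\<bar> + 1"
        by linarith
      then have "\<bar>real_of_int p\<bar> \<le> real q * (\<bar>eta_d b\<bar> + 1)"
        using q by (simp add: field_simps)
      also have "\<dots> \<le> real q0 * (\<bar>eta_d b\<bar> + 1)"
        using qq0 by (intro mult_right_mono) auto
      also have "\<dots> \<le> real_of_int c"
        unfolding c_def by (rule le_of_int_ceiling)
      finally have "real_of_int \<bar>p\<bar> \<le> real_of_int c"
        by simp
      then have "\<bar>p\<bar> \<le> c"
        by (simp only: of_int_le_iff)
      with qq0 show "p \<in> {-c..c} \<and> q \<in> {..<q0}"
        by auto
    qed
    then show ?thesis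
      by (rule finite_subset) auto
  qed
  then have "\<mu> \<le> 2" if "infinite (S \<mu>)" for \<mu>
    using that by (meson not_le)
  ultimately show "irrationality_exponent (eta_d b) = 2"
    unfolding irrationality_exponent_def S_def [symmetric]
    by (intro Sup_eqI) (auto intro: image_eqI [of _ _ 2])
qed

end
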